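(* Let $G$ be a graph and $r$ a positive integer. Then $\mathcal{R}(G)\cong \overline{K_r}$ (the edgeless graph on $r$ vertices) if and only if $G$ is an edgeless graph and $r=1$.
   Context: All graphs are finite, simple and undirected; $N(v)$ denotes the open neighbourhood of $v$. A set $S\subseteq V(G)$ is a dominating set if every vertex of $G$ is in $S$ or adjacent to a vertex of $S$; it is a minimal dominating set if no proper subset of $S$ is a dominating set. The reconfiguration graph $\mathcal{R}(G)$ has as vertex set the collection of all minimal dominating sets of $G$, and two minimal dominating sets $M_1,M_2$ are adjacent iff there is a vertex $v$ with either ($M_2\setminus M_1=\{v\}$ and $M_1\setminus M_2\subseteq N(v)$) or ($M_1\setminus M_2=\{v\}$ and $M_2\setminus M_1\subseteq N(v)$). *)

theory Defs
  imports "Graph_Theory.Pair_Digraph" "Graph_Theory.Digraph_Isomorphism"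
begin

text \<open>
  A finite simple undirected graph is a \<^const>\<open>pair_graph\<close>: a finite, loop-free, symmetric digraph
  whose arcs are pairs of vertices, an edge between \<open>u\<close> and \<open>v\<close> being the two arcs \<open>(u, v)\<close>
  and \<open>(v, u)\<close>.
\<close>

definition nbhd :: "'a pair_pre_digraph \<Rightarrow> 'a \<Rightarrow> 'a set" where
  "nbhd G v = {u. (v, u) \<in> parcs G}"

definition dominating_set :: "'a pair_pre_digraph \<Rightarrow> 'a set \<Rightarrow> bool" where
  "dominating_set G S \<longleftrightarrow>
     S \<subseteq> pverts G \<and> (\<forall>v \<in> pverts G. v \<in> S \<or> (\<exists>u \<in> S. u \<in> nbhd G v))"

definition minimal_dominating_set :: "'a pair_pre_digraph \<Rightarrow> 'a set \<Rightarrow> bool" where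
  "minimal_dominating_set G S \<longleftrightarrow>
     dominating_set G S \<and> (\<forall>T. T \<subset> S \<longrightarrow> \<not> dominating_set G T)"

definition reconf_adj :: "'a pair_pre_digraph \<Rightarrow> 'a set \<Rightarrow> 'a set \<Rightarrow> bool" where
  "reconf_adj G M1 M2 \<longleftrightarrow>
     (\<exists>v \<in> pverts G. (M2 - M1 = {v} \<and> M1 - M2 \<subseteq> nbhd G v) \<or>
                      (M1 - M2 = {v} \<and> M2 - M1 \<subseteq> nbhd G v))"

definition reconf_graph :: "'a pair_pre_digraph \<Rightarrow> 'a set pair_pre_digraph" where
  "reconf_graph G =
     \<lparr> pverts = {M. minimal_dominating_set G M},
       parcs = {(M1, M2). minimal_dominating_set G M1 \<and> minimal_dominating_set G M2 \<and>
                          reconf_adj G M1 M2} \<rparr>"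

definition empty_graph :: "nat \<Rightarrow> nat pair_pre_digraph" where
  "empty_graph r = \<lparr> pverts = {..<r}, parcs = {} \<rparr>"

definition edgeless :: "'a pair_pre_digraph \<Rightarrow> bool" where
  "edgeless G \<longleftrightarrow> parcs G = {}"

lemma pair_graph_reconf_graph:
  assumes "pair_graph G"
  shows "pair_graph (reconf_graph G)"
proof -
  interpret pair_graph G by fact
  have "pverts (reconf_graph G) \<subseteq> Pow (pverts G)"
    by (auto simp: reconf_graph_def minimal_dominating_set_def dominating_set_def)
  then have fin: "finite (pverts (reconf_graph G))"
    by (rule finite_subset) (simp add: pair_finite_verts)
  have sub: "parcs (reconf_graph G) \<subseteq> pverts (reconf_graph G) \<times> pverts (reconf_graph G)"
    by (auto simp: reconf_graph_def)
  have fin': "finite (parcs (reconf_graph G))"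
    by (rule finite_subset[OF sub]) (simp add: fin)
  show ?thesis
    using sub fin fin'
    by unfold_locales
       (auto simp: symmetric_def sym_def reconf_graph_def reconf_adj_def)
qed

lemma pair_graph_empty_graph: "pair_graph (empty_graph r)"
  by unfold_locales (auto simp: empty_graph_def symmetric_def sym_def)

end

theory Submission
  imports Defs
begin

text \<open>
  Suppose \<open>G\<close> has an edge and let \<open>I\<close> be a maximum independent set. Some \<open>w \<in> I\<close> has a neighbour
  \<open>v\<close> such that \<open>I - {w} \<union> {v}\<close> is still dominating: if \<open>w\<close> has an external private neighbour
  \<open>x\<close>, take \<open>v = x\<close>, since a second private neighbour \<open>y\<close> not adjacent to \<open>x\<close> would make
  \<open>I - {w} \<union> {x, y}\<close> a larger independent set; otherwise any neighbour of \<open>w\<close> will do.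
  A minimal dominating subset \<open>D\<close> of \<open>I - {w} \<union> {v}\<close> contains \<open>v\<close> because \<open>I\<close> is minimal, and it
  only loses neighbours of \<open>v\<close> because \<open>I\<close> is independent, so \<open>D\<close> and \<open>I\<close> are adjacent in the
  reconfiguration graph.
\<close>

definition independent_set :: "'a pair_pre_digraph \<Rightarrow> 'a set \<Rightarrow> bool" where
  "independent_set G S \<longleftrightarrow> S \<subseteq> pverts G \<and> (\<forall>u \<in> S. \<forall>v \<in> S. (u, v) \<notin> parcs G)"

text \<open>Finiteness of \<open>S\<close> gives an inclusion-minimal dominating subset. This turns
  a dominating set obtained by an exchange into a vertex of the reconfiguration graph.\<close>

lemma dominating_set_contains_minimal:
  assumes "finite S" and "dominating_set G S"
  obtains D where "D \<subseteq> S" and "minimal_dominating_set G D"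
proof -
  let ?P = "\<lambda>T. T \<subseteq> S \<and> dominating_set G T"
  have "finite {T. ?P T}"
    using assms(1) by (auto intro: finite_subset[of _ "Pow S"])
  moreover have "{T. ?P T} \<noteq> {}"
    using assms(2) by blast
  ultimately obtain D where D: "D \<in> {T. ?P T}" and min: "\<forall>T \<in> {T. ?P T}. T \<subseteq> D \<longrightarrow> D = T"
    using finite_has_minimal by meson
  have "\<not> dominating_set G T" if "T \<subset> D" for T
    using min D that by (metis (mono_tags, lifting) mem_Collect_eq psubset_eq subset_trans)
  then show ?thesis
    using D by (intro that[of D]) (simp_all add: minimal_dominating_set_def)
qed

context pair_graph
begin

lemma arc_commute: "(u, v) \<in> parcs G \<longleftrightarrow> (v, u) \<in> parcs G"
  using arcs_symmetric by blast

text \<open>A vertex dropped from \<open>S\<close> has no neighbour in \<open>S\<close>, so nothing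
  that remains dominates it.\<close>

lemma independent_dominating_imp_minimal:
  assumes "independent_set G S" and "dominating_set G S"
  shows "minimal_dominating_set G S"
  unfolding minimal_dominating_set_def
proof (intro conjI allI impI)
  fix T assume "T \<subset> S"
  then obtain v where "v \<in> S" "v \<notin> T" by blast
  moreover have "v \<in> pverts G" and "\<forall>u \<in> T. u \<notin> nbhd G v"
    using \<open>v \<in> S\<close> \<open>T \<subset> S\<close> assms(1) by (auto simp: independent_set_def nbhd_def)
  ultimately show "\<not> dominating_set G T"
    by (auto simp: dominating_set_def)
qed (rule assms(2))

lemma maximum_independent_set_exists:
  obtains I where "independent_set G I" and "\<forall>J. independent_set G J \<longrightarrow> card J \<le> card I"
proof -
  have "independent_set G {}" by (simp add: independent_set_def)
  moreover have "card J < Suc (card (pverts G))" if "independent_set G J" for J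
    using that pair_finite_verts by (auto simp: independent_set_def less_Suc_eq_le intro: card_mono)
  ultimately show ?thesis
    using ex_has_greatest_nat[of "independent_set G" "{}" card] that by metis
qed

text \<open>An undominated vertex could be added to \<open>I\<close>, giving a larger independent
  set.\<close>

lemma maximum_independent_set_dominating:
  assumes I: "independent_set G I" and max: "\<And>J. independent_set G J \<Longrightarrow> card J \<le> card I"
  shows "dominating_set G I"
  unfolding dominating_set_def
proof (intro conjI ballI)
  show "I \<subseteq> pverts G" using I by (simp add: independent_set_def)
  then have "finite I" using pair_finite_verts by (rule finite_subset)
  fix v assume v: "v \<in> pverts G"
  show "v \<in> I \<or> (\<exists>u\<in>I. u \<in> nbhd G v)"
  proof (rule ccontr)
    assume *: "\<not> ?thesis"
    then have "independent_set G (insert v I)"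
      using I v no_loops' arc_commute unfolding independent_set_def nbhd_def by blast
    from max[OF this] show False using * \<open>finite I\<close> by simp
  qed
qed

lemma maximum_independent_set_exchange:
  assumes I: "independent_set G I" and max: "\<And>J. independent_set G J \<Longrightarrow> card J \<le> card I"
    and w: "w \<in> I" and wu: "(w, u) \<in> parcs G"
  obtains v where "(w, v) \<in> parcs G" and "dominating_set G (insert v (I - {w}))"
proof -
  have dom: "dominating_set G I" by (rule maximum_independent_set_dominating[OF I max])
  have sub: "I \<subseteq> pverts G" using I by (simp add: independent_set_def)
  then have "finite I" using pair_finite_verts by (rule finite_subset)
  \<comment> \<open>The external private neighbours of \<open>w\<close>: apart from \<open>w\<close>
    itself, only these can lose domination when \<open>w\<close> leaves \<open>I\<close>.\<close>
  let ?P = "{x \<in> pverts G. x \<notin> I \<and> nbhd G x \<inter> I = {w}}"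
  have exchange: "dominating_set G (insert v (I - {w}))"
    if v: "(w, v) \<in> parcs G" and P: "\<And>y. y \<in> ?P \<Longrightarrow> y = v \<or> (y, v) \<in> parcs G" for v
    unfolding dominating_set_def
  proof (intro conjI ballI)
    show "insert v (I - {w}) \<subseteq> pverts G"
      using v sub in_arcsD2 by blast
    fix y assume y: "y \<in> pverts G"
    show "y \<in> insert v (I - {w}) \<or> (\<exists>u\<in>insert v (I - {w}). u \<in> nbhd G y)"
    proof (cases "y \<in> I \<or> y \<in> ?P")
      case True
      then show ?thesis using P v by (auto simp: nbhd_def)
    next
      case False
      \<comment> \<open>Since \<open>y\<close> is neither in \<open>I\<close> nor private to
        \<open>w\<close>, it has a neighbour in \<open>I\<close> other than
        \<open>w\<close>.\<close>
      then have "\<exists>u \<in> I. u \<in> nbhd G y" using dom y unfolding dominating_set_def by blast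
      then show ?thesis using False y w by blast
    qed
  qed
  show ?thesis
  proof (cases "?P = {}")
    case True
    then show ?thesis using that exchange wu by blast
  next
    case False
    then obtain x where x: "x \<in> ?P" by blast
    then have "w \<in> nbhd G x" by blast
    then have wx: "(w, x) \<in> parcs G" using arc_commute by (simp add: nbhd_def)
    have "y = x \<or> (y, x) \<in> parcs G" if y: "y \<in> ?P" for y
    proof (rule ccontr)
      assume ne: "\<not> ?thesis"
      have out: "(z, a) \<notin> parcs G \<and> (a, z) \<notin> parcs G" if "z \<in> ?P" "a \<in> I - {w}" for z a
        using that arc_commute unfolding nbhd_def by blast
      \<comment> \<open>Within \<open>I\<close>, both \<open>x\<close> and \<open>y\<close> are
        adjacent to \<open>w\<close> only, so replacing \<open>w\<close> by both keeps
        independence.\<close>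
      have "independent_set G (insert x (insert y (I - {w})))"
        using I x y ne out[OF x] out[OF y] no_loops' arc_commute
        unfolding independent_set_def by blast
      from max[OF this] have "card (insert x (insert y (I - {w}))) \<le> card I" .
      moreover have "x \<notin> insert y (I - {w})" and "y \<notin> I - {w}"
        using x y ne by auto
      then have "card (insert x (insert y (I - {w}))) = Suc (Suc (card (I - {w})))"
        using \<open>finite I\<close> by simp
      then have "card (insert x (insert y (I - {w}))) = Suc (card I)"
        by (simp only: card_Suc_Diff1[OF \<open>finite I\<close> w])
      ultimately show False by simp
    qed
    then show ?thesis using that[OF wx] exchange[OF wx] by blast
  qed
qed

lemma reconf_graph_has_arc:
  assumes "parcs G \<noteq> {}"
  shows "parcs (reconf_graph G) \<noteq> {}"
proof -
  obtain I where I: "independent_set G I"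
    and max: "\<forall>J. independent_set G J \<longrightarrow> card J \<le> card I"
    by (rule maximum_independent_set_exists)
  have dom: "dominating_set G I" by (rule maximum_independent_set_dominating[OF I max[rule_format]])
  have min: "minimal_dominating_set G I" by (rule independent_dominating_imp_minimal[OF I dom])
  obtain a b where ab: "(a, b) \<in> parcs G" using assms by auto
  then have "a \<in> pverts G" by (rule in_arcsD1)
  \<comment> \<open>Either \<open>a\<close> is in \<open>I\<close> and has the neighbour
    \<open>b\<close>, or a neighbour of \<open>a\<close> is in \<open>I\<close>.\<close>
  then obtain w u where w: "w \<in> I" "(w, u) \<in> parcs G"
    using dom ab arc_commute unfolding dominating_set_def nbhd_def by blast
  obtain v where wv: "(w, v) \<in> parcs G" and dv: "dominating_set G (insert v (I - {w}))"
    using maximum_independent_set_exchange[OF I max[rule_format] w] by blast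
  have "finite (insert v (I - {w}))"
    using dv pair_finite_verts finite_subset unfolding dominating_set_def by metis
  then obtain D where D: "D \<subseteq> insert v (I - {w})" and minD: "minimal_dominating_set G D"
    using dv by (rule dominating_set_contains_minimal)
  then have domD: "dominating_set G D" by (simp add: minimal_dominating_set_def)
  have "v \<notin> I" using I w(1) wv by (auto simp: independent_set_def)
  moreover have "v \<in> D"
  proof (rule ccontr)
    assume "v \<notin> D"
    then have "D \<subset> I" using D w(1) by blast
    then show False using min domD by (simp add: minimal_dominating_set_def)
  qed
  ultimately have "D - I = {v}" using D by blast
  moreover have "I - D \<subseteq> nbhd G v"
  proof
    fix z assume z: "z \<in> I - D"
    then have "z \<in> pverts G" using I by (auto simp: independent_set_def)
    \<comment> \<open>Here \<open>c\<close> is \<open>v\<close> or lies in \<open>I\<close>;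
      independence of \<open>I\<close> excludes the latter.\<close>
    then obtain c where "c \<in> D" "(z, c) \<in> parcs G"
      using domD z unfolding dominating_set_def nbhd_def by blast
    then show "z \<in> nbhd G v"
      using D z I arc_commute unfolding independent_set_def nbhd_def by blast
  qed
  moreover have "v \<in> pverts G" using wv by (rule in_arcsD2)
  ultimately have "reconf_adj G I D" unfolding reconf_adj_def by blast
  then have "(I, D) \<in> parcs (reconf_graph G)" using min minD by (simp add: reconf_graph_def)
  then show ?thesis by blast
qed

end

text \<open>Without edges a vertex dominates only itself, so the full vertex set is the sole
  dominating set.\<close>

lemma reconf_graph_edgeless:
  assumes "edgeless G"
  shows "reconf_graph G = \<lparr>pverts = {pverts G}, parcs = {}\<rparr>"
proof -
  have "dominating_set G S \<longleftrightarrow> S = pverts G" for S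
    using assms by (auto simp: edgeless_def dominating_set_def nbhd_def)
  then have "minimal_dominating_set G S \<longleftrightarrow> S = pverts G" for S
    by (auto simp: minimal_dominating_set_def)
  then show ?thesis
    by (auto simp: reconf_graph_def reconf_adj_def)
qed

theorem theorem10:
  fixes G :: "'a pair_pre_digraph" and r :: nat
  assumes "pair_graph G" and "0 < r"
  shows "digraph_iso (with_proj (reconf_graph G)) (with_proj (empty_graph r))
         \<longleftrightarrow> edgeless G \<and> r = 1"
proof
  assume "digraph_iso (with_proj (reconf_graph G)) (with_proj (empty_graph r))"
  then obtain h where h: "pre_digraph.digraph_isomorphism (with_proj (reconf_graph G)) h"
    and eq: "with_proj (empty_graph r) = app_iso h (with_proj (reconf_graph G))"
    unfolding digraph_iso_def by blast
  have "parcs (reconf_graph G) = {}"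
    using arg_cong[OF eq, of arcs] by (simp add: empty_graph_def)
  then have "edgeless G"
    using pair_graph.reconf_graph_has_arc[OF assms(1)] by (auto simp: edgeless_def)
  moreover have "{..<r} = iso_verts h ` pverts (reconf_graph G)"
    using arg_cong[OF eq, of verts] by (simp add: empty_graph_def)
  then have "{..<r} = {iso_verts h (pverts G)}"
    using reconf_graph_edgeless[OF \<open>edgeless G\<close>] by simp
  then have "card {..<r} = 1" by simp
  ultimately show "edgeless G \<and> r = 1" by simp
next
  assume *: "edgeless G \<and> r = 1"
  let ?R = "with_proj (reconf_graph G)"
  define h :: "('a set, 'a set \<times> 'a set, nat, nat \<times> nat) digraph_isomorphism" where
    \<comment> \<open>The single vertex goes to \<open>0\<close>. With no arcs present, the value of
      \<open>iso_arcs\<close> is arbitrary, while \<open>snd\<close> and \<open>fst\<close> must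
      match the head and tail maps of \<open>with_proj\<close>.\<close>
    "h = \<lparr>iso_verts = \<lambda>_. 0, iso_arcs = \<lambda>_. (0, 0), iso_head = snd, iso_tail = fst\<rparr>"
  have R: "reconf_graph G = \<lparr>pverts = {pverts G}, parcs = {}\<rparr>"
    using * by (simp add: reconf_graph_edgeless)
  have "wf_digraph ?R"
    using R by (intro wf_digraph.intro) auto
  then have "pre_digraph.digraph_isomorphism ?R h"
    using R by (simp add: pre_digraph.digraph_isomorphism_def h_def)
  moreover have "with_proj (empty_graph r) = app_iso h ?R"
    using * R by (auto simp: app_iso_def h_def empty_graph_def with_proj_def lessThan_Suc)
  ultimately show "digraph_iso ?R (with_proj (empty_graph r))"
    unfolding digraph_iso_def by blast
qed

end
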